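(* Let $X$ be a real Hilbert space. In the metric space $(\mathcal J(X),\hat\rho)$, the set $$\{T\in\mathcal J(X):\ T\text{ is super-regular}\}$$ is residual.
   Context: $X$ is a real Hilbert space with inner product $\langle\cdot,\cdot\rangle$ and norm $\|\cdot\|$. $\mathcal J(X)$ is the set of firmly nonexpansive maps $T:X\to X$, i.e., $\|Tx-Ty\|^2\le\langle Tx-Ty,x-y\rangle$ for all $x,y\in X$. For maps $S_1,S_2:X\to X$ put $\|S_1-S_2\|_n:=\sup_{\|x\|\le n}\|S_1x-S_2x\|$. The metric on $\mathcal J(X)$ is $$\hat\rho(T_1,T_2):=\sum_{n=1}^\infty\frac1{2^n}\frac{\|2T_1-2T_2\|_n}{1+\|2T_1-2T_2\|_n};$$ $(\mathcal J(X),\hat\rho)$ is a complete metric space. A map $T:X\to X$ is super-regular if there exists a unique $x_T\in X$ such that for each $s>0$, $T^nx\to x_T$ as $n\to\infty$ uniformly for $x$ in the closed ball $\{x:\|x\|\le s\}$. A subset $S$ of a complete metric space $Y$ is residual if there is a sequence of dense open sets $O_n\subset Y$ with $\bigcap_{n=1}^\infty O_n\subset S$. *)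

theory Defs
  imports "HOL-Analysis.Analysis"
begin

definition firmly_nonexpansive :: "('a::real_inner \<Rightarrow> 'a) \<Rightarrow> bool" where
  "firmly_nonexpansive T \<longleftrightarrow>
     (\<forall>x y. (norm (T x - T y))\<^sup>2 \<le> (T x - T y) \<bullet> (x - y))"

definition firmly_nonexpansive_maps :: "('a::real_inner \<Rightarrow> 'a) set" where
  "firmly_nonexpansive_maps = {T. firmly_nonexpansive T}"

text \<open>The supremum is taken in the reals; it is meaningful when the difference of the two maps
  is bounded on the ball, which firm nonexpansiveness guarantees
  (\<open>bdd_above_ball_dist\<close> below).\<close>

definition ball_dist :: "nat \<Rightarrow> ('a::real_normed_vector \<Rightarrow> 'a) \<Rightarrow> ('a \<Rightarrow> 'a) \<Rightarrow> real" where
  "ball_dist n S T = (SUP x\<in>cball 0 (real n). norm (S x - T x))"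

text \<open>The value 0 outside of the set of firmly nonexpansive maps is a totalization: the locale
  \<open>Metric_space\<close> requires nonnegativity on the whole type. The series starts at
  index 1, hence the shift by \<open>Suc\<close>.\<close>

definition rho_hat :: "('a::real_inner \<Rightarrow> 'a) \<Rightarrow> ('a \<Rightarrow> 'a) \<Rightarrow> real" where
  "rho_hat S T =
     (if S \<in> firmly_nonexpansive_maps \<and> T \<in> firmly_nonexpansive_maps then
        (\<Sum>k. 1 / 2 ^ Suc k *
           (ball_dist (Suc k) (\<lambda>x. 2 *\<^sub>R S x) (\<lambda>x. 2 *\<^sub>R T x) /
             (1 + ball_dist (Suc k) (\<lambda>x. 2 *\<^sub>R S x) (\<lambda>x. 2 *\<^sub>R T x))))
      else 0)"

definition super_regular :: "('a::real_normed_vector \<Rightarrow> 'a) \<Rightarrow> bool" where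
  "super_regular T \<longleftrightarrow>
     (\<exists>!xT. \<forall>s>0. uniform_limit (cball 0 s) (\<lambda>n. T ^^ n) (\<lambda>_. xT) sequentially)"

definition residual_in :: "'a topology \<Rightarrow> 'a set \<Rightarrow> bool" where
  "residual_in X S \<longleftrightarrow> S \<subseteq> topspace X \<and>
     (\<exists>G :: nat \<Rightarrow> 'a set.
        (\<forall>n. openin X (G n) \<and> X closure_of (G n) = topspace X) \<and> (\<Inter>n. G n) \<subseteq> S)"

lemma firmly_nonexpansive_norm_le:
  assumes "firmly_nonexpansive T"
  shows "norm (T x - T y) \<le> norm (x - y)"
proof -
  have "norm (T x - T y) * norm (T x - T y) \<le> norm (T x - T y) * norm (x - y)"
    using assms norm_cauchy_schwarz[of "T x - T y" "x - y"]
    unfolding firmly_nonexpansive_def power2_eq_square by (meson order_trans)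
  then show ?thesis
    by (cases "norm (T x - T y) = 0") (auto simp: mult_le_cancel_left)
qed

lemma bdd_above_ball_dist:
  assumes "firmly_nonexpansive S" "firmly_nonexpansive T"
  shows "bdd_above ((\<lambda>x. norm (2 *\<^sub>R S x - 2 *\<^sub>R T x)) ` cball 0 r)"
proof (rule bdd_aboveI2)
  fix x :: 'a assume "x \<in> cball 0 r"
  then have x: "norm x \<le> r" by simp
  have "norm (2 *\<^sub>R S x - 2 *\<^sub>R T x) = 2 * norm (S x - T x)"
    by (metis abs_numeral norm_scaleR scaleR_diff_right)
  moreover have "norm (S x - T x) \<le> norm (S x - S 0) + norm (S 0 - T 0) + norm (T x - T 0)"
    by (smt (verit) norm_diff_triangle_le norm_minus_commute order_refl)
  ultimately show "norm (2 *\<^sub>R S x - 2 *\<^sub>R T x) \<le> 2 * (r + norm (S 0 - T 0) + r)"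
    using firmly_nonexpansive_norm_le[OF assms(1), of x 0]
      firmly_nonexpansive_norm_le[OF assms(2), of x 0] x by simp
qed

context
begin

private abbreviation (input) D :: "nat \<Rightarrow> ('a::real_inner \<Rightarrow> 'a) \<Rightarrow> ('a \<Rightarrow> 'a) \<Rightarrow> real" where
  "D n S T \<equiv> ball_dist n (\<lambda>x. 2 *\<^sub>R S x) (\<lambda>x. 2 *\<^sub>R T x)"

private abbreviation (input) J :: "('a::real_inner \<Rightarrow> 'a) set" where
  "J \<equiv> firmly_nonexpansive_maps"

private lemma D_upper:
  assumes "S \<in> J" "T \<in> J" "norm x \<le> real n"
  shows "2 * norm (S x - T x) \<le> D n S T"
proof -
  have "norm (2 *\<^sub>R S x - 2 *\<^sub>R T x) \<le> D n S T"
    unfolding ball_dist_def using assms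
    by (intro cSUP_upper bdd_above_ball_dist) (auto simp: firmly_nonexpansive_maps_def)
  moreover have "norm (2 *\<^sub>R S x - 2 *\<^sub>R T x) = 2 * norm (S x - T x)"
    by (metis abs_numeral norm_scaleR scaleR_diff_right)
  ultimately show ?thesis by simp
qed

private lemma D_least:
  assumes "\<And>x. norm x \<le> real n \<Longrightarrow> 2 * norm (S x - T x) \<le> c"
  shows "D n S T \<le> c"
  unfolding ball_dist_def
proof (rule cSUP_least)
  fix x :: 'a assume "x \<in> cball 0 (real n)"
  moreover have "norm (2 *\<^sub>R S x - 2 *\<^sub>R T x) = 2 * norm (S x - T x)"
    by (metis abs_numeral norm_scaleR scaleR_diff_right)
  ultimately show "norm (2 *\<^sub>R S x - 2 *\<^sub>R T x) \<le> c" using assms[of x] by simp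
qed simp

private lemma D_nonneg:
  assumes "S \<in> J" "T \<in> J" shows "0 \<le> D n S T"
  using D_upper[OF assms, of 0 n] by (smt (verit) norm_ge_zero norm_zero of_nat_0_le_iff)

private lemma D_commute: "D n S T = D n T S"
  by (simp add: ball_dist_def norm_minus_commute)

private lemma D_triangle:
  assumes "S \<in> J" "T \<in> J" "U \<in> J" shows "D n S U \<le> D n S T + D n T U"
proof (rule D_least)
  fix x :: 'a assume x: "norm x \<le> real n"
  have "norm (S x - U x) \<le> norm (S x - T x) + norm (T x - U x)"
    using norm_triangle_ineq[of "S x - T x" "T x - U x"] by simp
  then show "2 * norm (S x - U x) \<le> D n S T + D n T U"
    using D_upper[OF assms(1,2) x] D_upper[OF assms(2,3) x] by linarith
qed

private definition tm :: "nat \<Rightarrow> ('a::real_inner \<Rightarrow> 'a) \<Rightarrow> ('a \<Rightarrow> 'a) \<Rightarrow> real" where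
  "tm k S T = 1 / 2 ^ Suc k * (D (Suc k) S T / (1 + D (Suc k) S T))"

private lemma rho_eq: "S \<in> J \<Longrightarrow> T \<in> J \<Longrightarrow> rho_hat S T = (\<Sum>k. tm k S T)"
  by (simp add: rho_hat_def tm_def)

private lemma tm_nonneg: "S \<in> J \<Longrightarrow> T \<in> J \<Longrightarrow> 0 \<le> tm k S T"
  using D_nonneg[of S T "Suc k"] by (simp add: tm_def)

private lemma tm_le_geom: 
  assumes "S \<in> J" "T \<in> J" shows "tm k S T \<le> (1/2) ^ Suc k"
proof -
  have "D (Suc k) S T / (1 + D (Suc k) S T) \<le> 1"
    using D_nonneg[OF assms, of "Suc k"] by simp
  then show ?thesis
    unfolding tm_def by (simp add: power_one_over divide_simps)
qed

private lemma tm_summable: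
  assumes "S \<in> J" "T \<in> J" shows "summable (\<lambda>k. tm k S T)"
proof (rule summable_comparison_test')
  show "summable (\<lambda>k. (1/2::real) ^ Suc k)"
    using power_half_series sums_summable by blast
  show "norm (tm k S T) \<le> (1/2) ^ Suc k" if "k \<ge> 0" for k
    using tm_nonneg[OF assms] tm_le_geom[OF assms] by simp
qed

private lemma frac_mono: "0 \<le> a \<Longrightarrow> a \<le> b \<Longrightarrow> a / (1 + a) \<le> b / (1 + (b::real))"
  by (simp add: field_simps)

private lemma frac_subadd: 
  assumes "0 \<le> a" "0 \<le> b" shows "(a + b) / (1 + (a + b)) \<le> a / (1 + a) + b / (1 + (b::real))"
proof -
  have "a / (1 + (a + b)) \<le> a / (1 + a)" "b / (1 + (a + b)) \<le> b / (1 + b)"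
    using assms by (auto intro!: divide_left_mono mult_pos_pos)
  then show ?thesis by (simp add: add_divide_distrib)
qed

private lemma tm_triangle:
  assumes "S \<in> J" "T \<in> J" "U \<in> J" shows "tm k S U \<le> tm k S T + tm k T U"
proof -
  have "D (Suc k) S U / (1 + D (Suc k) S U)
      \<le> D (Suc k) S T / (1 + D (Suc k) S T) + D (Suc k) T U / (1 + D (Suc k) T U)"
    using frac_mono[OF D_nonneg[OF assms(1,3)] D_triangle[OF assms]]
      frac_subadd[OF D_nonneg[OF assms(1,2)] D_nonneg[OF assms(2,3)]] by (rule order_trans)
  then have "1 / 2 ^ Suc k * (D (Suc k) S U / (1 + D (Suc k) S U))
      \<le> 1 / 2 ^ Suc k * (D (Suc k) S T / (1 + D (Suc k) S T) + D (Suc k) T U / (1 + D (Suc k) T U))"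
    by (rule mult_left_mono) simp
  then show ?thesis unfolding tm_def by (simp only: distrib_left)
qed

theorem Metric_space_rho_hat:
  "Metric_space (firmly_nonexpansive_maps :: ('a::real_inner \<Rightarrow> 'a) set) rho_hat"
proof
  fix S T U :: "'a \<Rightarrow> 'a"
  show "0 \<le> rho_hat S T"
  proof (cases "S \<in> J \<and> T \<in> J")
    case True
    then show ?thesis by (simp add: rho_eq suminf_nonneg tm_summable tm_nonneg)
  qed (auto simp: rho_hat_def)
  show "rho_hat S T = rho_hat T S"
    unfolding rho_hat_def by (subst (1 2) D_commute) auto
  show "rho_hat S T = 0 \<longleftrightarrow> S = T" if "S \<in> J" "T \<in> J"
  proof
    assume "S = T"
    then have "D n S T = 0" for n
      using D_least[of n S T 0] D_nonneg[OF that, of n] by simp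
    then show "rho_hat S T = 0" by (simp add: rho_hat_def)
  next
    assume "rho_hat S T = 0"
    then have tm0: "tm k S T = 0" for k
      using that suminf_eq_zero_iff[OF tm_summable[OF that] tm_nonneg[OF that]] rho_eq by metis
    then have D0: "D (Suc k) S T = 0" for k
    proof -
      have "D (Suc k) S T = 0 \<or> 1 + D (Suc k) S T = 0"
        using tm0[of k] by (simp add: tm_def)
      then show ?thesis using D_nonneg[OF that, of "Suc k"] by linarith
    qed
    show "S = T"
    proof
      fix x :: 'a
      obtain n where "norm x \<le> real n" using real_arch_simple by blast
      then have "norm x \<le> real (Suc n)" by simp
      then have "2 * norm (S x - T x) \<le> 0" using D_upper[OF that, of x "Suc n"] D0 by simp
      then show "S x = T x" by simp
    qed
  qed
  show "rho_hat S U \<le> rho_hat S T + rho_hat T U" if "S \<in> J" "T \<in> J" "U \<in> J"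
    using that by (simp add: rho_eq suminf_add tm_summable suminf_le summable_add tm_triangle)
qed

private lemma tm_le_rho:
  assumes "S \<in> J" "T \<in> J" shows "tm k S T \<le> rho_hat S T"
proof -
  have "sum (\<lambda>k. tm k S T) {k} \<le> (\<Sum>k. tm k S T)"
    by (rule sum_le_suminf) (auto simp: assms tm_summable tm_nonneg)
  then show ?thesis by (simp add: rho_eq assms)
qed

private lemma D_small:
  assumes "e > 0"
  obtains d where "d > 0"
    "\<And>S T :: 'a::real_inner \<Rightarrow> 'a. S \<in> J \<Longrightarrow> T \<in> J \<Longrightarrow> rho_hat S T < d \<Longrightarrow> D (Suc k) S T < e"
proof
  show "1 / 2 ^ Suc k * (e / (1 + e)) > 0" using assms by simp
  fix S T :: "'a \<Rightarrow> 'a" assume ST: "S \<in> J" "T \<in> J" and r: "rho_hat S T < 1 / 2 ^ Suc k * (e / (1 + e))"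
  show "D (Suc k) S T < e"
  proof (rule ccontr)
    assume "\<not> D (Suc k) S T < e"
    then have "1 / 2 ^ Suc k * (e / (1 + e)) \<le> tm k S T"
      unfolding tm_def using assms by (intro mult_left_mono frac_mono) auto
    then show False using r tm_le_rho[OF ST, of k] by linarith
  qed
qed

theorem mcomplete_rho_hat:
  "Metric_space.mcomplete
     (firmly_nonexpansive_maps :: ('a::{real_inner,complete_space} \<Rightarrow> 'a) set) rho_hat"
proof -
  interpret Metric_space "J :: ('a \<Rightarrow> 'a) set" rho_hat by (rule Metric_space_rho_hat)
  show ?thesis
    unfolding mcomplete_def
  proof (intro allI impI)
    fix \<sigma> :: "nat \<Rightarrow> 'a \<Rightarrow> 'a" assume C: "MCauchy \<sigma>"
    have J: "\<sigma> i \<in> J" for i using C by (auto simp: MCauchy_def)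
    have CD: "\<exists>N. \<forall>i\<ge>N. \<forall>j\<ge>N. D (Suc k) (\<sigma> i) (\<sigma> j) < e" if e: "e > 0" for k e
    proof -
      obtain d where "d > 0" and d: "\<And>S T :: 'a \<Rightarrow> 'a. S \<in> J \<Longrightarrow> T \<in> J \<Longrightarrow> rho_hat S T < d \<Longrightarrow> D (Suc k) S T < e"
        using D_small[OF e, of k] by metis
      then obtain N where "\<forall>n n'. N \<le> n \<longrightarrow> N \<le> n' \<longrightarrow> rho_hat (\<sigma> n) (\<sigma> n') < d"
        using C unfolding MCauchy_def by blast
      then show ?thesis using d J by blast
    qed
    have "Cauchy (\<lambda>i. \<sigma> i x)" for x
    proof (rule metric_CauchyI)
      fix e :: real assume "e > 0"
      obtain n where "norm x \<le> real n" using real_arch_simple by blast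
      then have x: "norm x \<le> real (Suc n)" by simp
      obtain N where N: "\<forall>i\<ge>N. \<forall>j\<ge>N. D (Suc n) (\<sigma> i) (\<sigma> j) < e" using CD[OF \<open>e > 0\<close>] by blast
      have "dist (\<sigma> i x) (\<sigma> j x) < e" if "i \<ge> N" "j \<ge> N" for i j
      proof -
        have "D (Suc n) (\<sigma> i) (\<sigma> j) < e" using N that by blast
        then show ?thesis
          using D_upper[OF J J x, of i j] norm_ge_zero[of "\<sigma> i x - \<sigma> j x"]
          unfolding dist_norm by linarith
      qed
      then show "\<exists>M. \<forall>m\<ge>M. \<forall>n\<ge>M. dist (\<sigma> m x) (\<sigma> n x) < e" by blast
    qed
    then have "\<forall>x. \<exists>l. (\<lambda>i. \<sigma> i x) \<longlonglongrightarrow> l" using Cauchy_convergent convergent_def by blast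
    then obtain T where T: "\<And>x. (\<lambda>i. \<sigma> i x) \<longlonglongrightarrow> T x" by metis
    have TJ: "T \<in> J"
      unfolding firmly_nonexpansive_maps_def firmly_nonexpansive_def
    proof (intro CollectI allI)
      fix x y
      show "(norm (T x - T y))\<^sup>2 \<le> (T x - T y) \<bullet> (x - y)"
      proof (rule LIMSEQ_le)
        show "(\<lambda>i. (norm (\<sigma> i x - \<sigma> i y))\<^sup>2) \<longlonglongrightarrow> (norm (T x - T y))\<^sup>2"
          by (intro tendsto_intros T)
        show "(\<lambda>i. (\<sigma> i x - \<sigma> i y) \<bullet> (x - y)) \<longlonglongrightarrow> (T x - T y) \<bullet> (x - y)"
          by (intro tendsto_intros T)
        show "\<exists>N. \<forall>n\<ge>N. (norm (\<sigma> n x - \<sigma> n y))\<^sup>2 \<le> (\<sigma> n x - \<sigma> n y) \<bullet> (x - y)"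
          using J by (auto simp: firmly_nonexpansive_maps_def firmly_nonexpansive_def)
      qed
    qed
    have DT: "(\<lambda>i. D (Suc k) (\<sigma> i) T) \<longlonglongrightarrow> 0" for k
    proof (rule LIMSEQ_I)
      fix e :: real assume "e > 0"
      obtain N where N: "\<forall>i\<ge>N. \<forall>j\<ge>N. D (Suc k) (\<sigma> i) (\<sigma> j) < e/2"
        using CD[of "e/2" k] \<open>e > 0\<close> by (meson half_gt_zero)
      have "D (Suc k) (\<sigma> i) T \<le> e/2" if "i \<ge> N" for i
      proof (rule D_least)
        fix x :: 'a assume x: "norm x \<le> real (Suc k)"
        show "2 * norm (\<sigma> i x - T x) \<le> e/2"
        proof (rule LIMSEQ_le_const2)
          show "(\<lambda>j. 2 * norm (\<sigma> i x - \<sigma> j x)) \<longlonglongrightarrow> 2 * norm (\<sigma> i x - T x)"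
            by (intro tendsto_intros T)
          show "\<exists>N. \<forall>j\<ge>N. 2 * norm (\<sigma> i x - \<sigma> j x) \<le> e / 2"
            using N that D_upper[OF J J x, of i] by (meson less_imp_le order_trans)
        qed
      qed
      then have "norm (D (Suc k) (\<sigma> i) T - 0) < e" if "i \<ge> N" for i
        using that D_nonneg[OF J TJ, of "Suc k" i] \<open>e > 0\<close> by fastforce
      then show "\<exists>no. \<forall>n\<ge>no. norm (D (Suc k) (\<sigma> n) T - 0) < e" by blast
    qed
    have "(\<forall>\<^sub>F i in sequentially. summable (\<lambda>k. norm (tm k (\<sigma> i) T))) \<and>
        summable (\<lambda>k::nat. norm (0::real)) \<and> (\<lambda>i. \<Sum>k. tm k (\<sigma> i) T) \<longlonglongrightarrow> (\<Sum>k. 0)"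
    proof (rule tannerys_theorem)
      show "(\<lambda>i. tm k (\<sigma> i) T) \<longlonglongrightarrow> 0" for k
        unfolding tm_def by (rule tendsto_eq_intros DT refl | simp)+
      show "summable (\<lambda>k. (1/2::real) ^ Suc k)"
        using power_half_series sums_summable by blast
      show "\<forall>\<^sub>F (k, i) in at_top \<times>\<^sub>F sequentially. norm (tm k (\<sigma> i) T) \<le> (1/2) ^ Suc k"
        using tm_nonneg[OF J TJ] tm_le_geom[OF J TJ] by (intro always_eventually) auto
    qed simp
    then have "(\<lambda>i. rho_hat (\<sigma> i) T) \<longlonglongrightarrow> 0" by (simp add: rho_eq J TJ)
    then have "limitin mtopology \<sigma> T sequentially"
      using J TJ by (simp add: limitin_metric_dist_null)
    then show "\<exists>T. limitin mtopology \<sigma> T sequentially" by blast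
  qed
qed

end

end

theory Submission
  imports Defs
begin

text \<open>
  Call a map \<open>S\<close> \<open>n\<close>-attracting if there is a point \<open>p\<close> such that all sufficiently high iterates
  of \<open>S\<close> send the ball of radius \<open>n\<close> about the origin into the ball of radius \<open>1 / (n + 1)\<close> about
  \<open>p\<close>. A map that is \<open>n\<close>-attracting for every \<open>n\<close> is super-regular
  (\<open>super_regular_if_attracting\<close>): the orbit of \<open>0\<close> is then Cauchy, and its limit attracts every
  ball uniformly. It therefore suffices that, for each \<open>n\<close>, the interior of the set of
  \<open>n\<close>-attracting firmly nonexpansive maps is dense.

  Strict contractions are dense, because \<open>c T\<close> is firmly nonexpansive and \<open>c\<close>-Lipschitz for
  \<open>0 \<le> c < 1\<close>, and \<open>c T\<close> tends to \<open>T\<close> uniformly on bounded sets as \<open>c\<close> tends to \<open>1\<close>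
  (\<open>rho_hat_scaleR_tendsto_0\<close>). They lie in the interior (\<open>attracting_near_contraction\<close>): if \<open>C\<close>
  is \<open>L\<close>-Lipschitz with \<open>L < 1\<close> and has the fixed point \<open>p\<close>, and \<open>S\<close> is within \<open>e\<close> of \<open>C\<close> on a
  ball about \<open>p\<close>, then \<open>norm (S x - p) \<le> L * norm (x - p) + e\<close> there. For small \<open>e\<close> the map \<open>S\<close>
  sends this ball into itself, and its iterates shrink it uniformly to
  within \<open>2 e / (1 - L)\<close> of \<open>p\<close>.
\<close>

section \<open>The metric and uniform convergence on bounded sets\<close>

lemma norm_diff_le_ball_dist:
  fixes S T :: "'a::real_inner \<Rightarrow> 'a"
  assumes "firmly_nonexpansive S" "firmly_nonexpansive T" "norm x \<le> real n"
  shows "2 * norm (S x - T x) \<le> ball_dist n (\<lambda>x. 2 *\<^sub>R S x) (\<lambda>x. 2 *\<^sub>R T x)"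
proof -
  have "norm (2 *\<^sub>R S x - 2 *\<^sub>R T x) \<le> ball_dist n (\<lambda>x. 2 *\<^sub>R S x) (\<lambda>x. 2 *\<^sub>R T x)"
    unfolding ball_dist_def using assms
    by (intro cSUP_upper bdd_above_ball_dist) auto
  moreover have "norm (2 *\<^sub>R S x - 2 *\<^sub>R T x) = 2 * norm (S x - T x)"
    by (metis abs_numeral norm_scaleR scaleR_diff_right)
  ultimately show ?thesis by simp
qed

lemma ball_dist_le:
  fixes S T :: "'a::real_inner \<Rightarrow> 'a"
  assumes "\<And>x. norm x \<le> real n \<Longrightarrow> norm (S x - T x) \<le> c"
  shows "ball_dist n (\<lambda>x. 2 *\<^sub>R S x) (\<lambda>x. 2 *\<^sub>R T x) \<le> 2 * c"
  unfolding ball_dist_def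
proof (rule cSUP_least)
  fix x :: 'a assume "x \<in> cball 0 (real n)"
  moreover have "norm (2 *\<^sub>R S x - 2 *\<^sub>R T x) = 2 * norm (S x - T x)"
    by (metis abs_numeral norm_scaleR scaleR_diff_right)
  ultimately show "norm (2 *\<^sub>R S x - 2 *\<^sub>R T x) \<le> 2 * c" using assms[of x] by simp
qed simp

lemma ball_dist_nonneg:
  fixes S T :: "'a::real_inner \<Rightarrow> 'a"
  assumes "firmly_nonexpansive S" "firmly_nonexpansive T"
  shows "0 \<le> ball_dist n (\<lambda>x. 2 *\<^sub>R S x) (\<lambda>x. 2 *\<^sub>R T x)"
  using norm_diff_le_ball_dist[OF assms, of 0 n] norm_ge_zero[of "S 0 - T 0"]
  by (simp del: norm_ge_zero)

lemma rho_hat_term_bounds: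
  fixes S T :: "'a::real_inner \<Rightarrow> 'a" and k :: nat
  assumes "firmly_nonexpansive S" "firmly_nonexpansive T"
  defines "d \<equiv> ball_dist (Suc k) (\<lambda>x. 2 *\<^sub>R S x) (\<lambda>x. 2 *\<^sub>R T x)"
  shows "0 \<le> 1 / 2 ^ Suc k * (d / (1 + d))"
    and "1 / 2 ^ Suc k * (d / (1 + d)) \<le> (1/2) ^ Suc k"
proof -
  have d: "0 \<le> d"
    unfolding d_def using assms(1,2) by (rule ball_dist_nonneg)
  then show "0 \<le> 1 / 2 ^ Suc k * (d / (1 + d))" by simp
  have "d / (1 + d) \<le> 1"
    using d by simp
  then show "1 / 2 ^ Suc k * (d / (1 + d)) \<le> (1/2) ^ Suc k"
    by (simp add: power_one_over divide_simps)
qed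

lemma rho_hat_term_le:
  fixes S T :: "'a::real_inner \<Rightarrow> 'a" and k :: nat
  assumes "firmly_nonexpansive S" "firmly_nonexpansive T"
  defines "d \<equiv> \<lambda>k. ball_dist (Suc k) (\<lambda>x. 2 *\<^sub>R S x) (\<lambda>x. 2 *\<^sub>R T x)"
  shows "1 / 2 ^ Suc k * (d k / (1 + d k)) \<le> rho_hat S T"
proof -
  define t where "t = (\<lambda>k. 1 / 2 ^ Suc k * (d k / (1 + d k)))"
  have t: "0 \<le> t k" "t k \<le> (1/2) ^ Suc k" for k
    using rho_hat_term_bounds[OF assms(1,2), of k] unfolding t_def d_def by auto
  have "summable t"
  proof (rule summable_comparison_test')
    show "summable (\<lambda>k. (1/2::real) ^ Suc k)"
      using power_half_series sums_summable by blast
  qed (use t in auto)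
  then have "sum t {k} \<le> suminf t"
    by (rule sum_le_suminf) (auto simp: t)
  then show ?thesis
    using assms(1,2) by (simp add: rho_hat_def firmly_nonexpansive_maps_def t_def d_def)
qed

text \<open>Conversely, closeness in \<open>rho_hat\<close> controls the distance on any given ball; the bound is
  uniform in the pair of maps.\<close>

lemma norm_diff_less_if_rho_hat_small:
  fixes R e :: real
  assumes "e > 0"
  obtains d where "d > 0"
    "\<And>(S :: 'a::real_inner \<Rightarrow> 'a) T x. \<lbrakk>firmly_nonexpansive S; firmly_nonexpansive T;
      rho_hat S T < d; norm x \<le> R\<rbrakk> \<Longrightarrow> norm (S x - T x) < e"
proof -
  obtain k where k: "R \<le> real k" using real_arch_simple by blast
  define d where "d = 1 / 2 ^ Suc k * (e / (1 + e))"
  show thesis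
  proof
    show "d > 0" using assms by (simp add: d_def)
    fix S T :: "'a \<Rightarrow> 'a" and x :: 'a
    assume ST: "firmly_nonexpansive S" "firmly_nonexpansive T"
      and r: "rho_hat S T < d" and x: "norm x \<le> R"
    define b where "b = ball_dist (Suc k) (\<lambda>x. 2 *\<^sub>R S x) (\<lambda>x. 2 *\<^sub>R T x)"
    have "b < e"
    proof (rule ccontr)
      assume "\<not> b < e"
      then have "e / (1 + e) \<le> b / (1 + b)"
        using assms by (simp add: field_simps)
      then have "d \<le> 1 / 2 ^ Suc k * (b / (1 + b))"
        unfolding d_def by (intro mult_left_mono) auto
      then show False
        using r rho_hat_term_le[OF ST, of k] unfolding b_def by linarith
    qed
    moreover have "2 * norm (S x - T x) \<le> b"
      unfolding b_def using x k by (intro norm_diff_le_ball_dist ST) simp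
    ultimately show "norm (S x - T x) < e"
      using norm_ge_zero[of "S x - T x"] by linarith
  qed
qed

text \<open>Uniform convergence on bounded sets implies convergence in \<open>rho_hat\<close>: each term of the
  series tends to \<open>0\<close> and is dominated by a geometric series, so Tannery's theorem applies.\<close>

lemma rho_hat_tendsto_0:
  fixes T :: "'a::real_inner \<Rightarrow> 'a"
  assumes S: "\<And>i. firmly_nonexpansive (S i)" and T: "firmly_nonexpansive T"
    and lim: "\<And>r. uniform_limit (cball 0 r) S T sequentially"
  shows "(\<lambda>i. rho_hat (S i) T) \<longlonglongrightarrow> 0"
proof -
  define d where "d = (\<lambda>k i. ball_dist (Suc k) (\<lambda>x. 2 *\<^sub>R S i x) (\<lambda>x. 2 *\<^sub>R T x))"
  define t where "t = (\<lambda>k i. 1 / 2 ^ Suc k * (d k i / (1 + d k i)))"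
  have bounds: "0 \<le> t k i" "t k i \<le> (1/2) ^ Suc k" for k i
    using rho_hat_term_bounds[OF S T, of k i] unfolding t_def d_def by auto
  have "d k \<longlonglongrightarrow> 0" for k
  proof (rule LIMSEQ_I)
    fix e :: real assume "e > 0"
    then have "\<forall>\<^sub>F i in sequentially. \<forall>x\<in>cball 0 (real (Suc k)). dist (S i x) (T x) < e / 4"
      by (intro uniform_limitD[OF lim]) simp
    then obtain N where
      N: "\<And>i. i \<ge> N \<Longrightarrow> \<forall>x\<in>cball 0 (real (Suc k)). dist (S i x) (T x) < e / 4"
      unfolding eventually_sequentially by blast
    have "norm (d k i - 0) < e" if "i \<ge> N" for i
    proof -
      have "d k i \<le> 2 * (e / 4)"
        unfolding d_def using N[OF that] by (intro ball_dist_le) (auto simp: dist_norm less_imp_le)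
      moreover have "0 \<le> d k i"
        unfolding d_def using S T by (rule ball_dist_nonneg)
      ultimately show ?thesis using \<open>e > 0\<close> by simp
    qed
    then show "\<exists>N. \<forall>i\<ge>N. norm (d k i - 0) < e" by blast
  qed
  note d_lim = this
  have "(\<forall>\<^sub>F i in sequentially. summable (\<lambda>k. norm (t k i))) \<and>
      summable (\<lambda>k::nat. norm (0::real)) \<and> (\<lambda>i. \<Sum>k. t k i) \<longlonglongrightarrow> (\<Sum>k. 0)"
  proof (rule tannerys_theorem)
    show "t k \<longlonglongrightarrow> 0" for k
      unfolding t_def by (rule tendsto_eq_intros d_lim refl | simp)+
    show "summable (\<lambda>k. (1/2::real) ^ Suc k)"
      using power_half_series sums_summable by blast
    show "\<forall>\<^sub>F (k, i) in at_top \<times>\<^sub>F sequentially. norm (t k i) \<le> (1/2) ^ Suc k"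
      using bounds by (intro always_eventually) auto
  qed simp
  then show ?thesis
    using S T by (simp add: rho_hat_def firmly_nonexpansive_maps_def t_def d_def)
qed

section \<open>Density of the strict contractions\<close>

lemma firmly_nonexpansive_scaleR:
  assumes T: "firmly_nonexpansive T" and c: "0 \<le> c" "c \<le> 1"
  shows "firmly_nonexpansive (\<lambda>x. c *\<^sub>R T x)"
  unfolding firmly_nonexpansive_def
proof (intro allI)
  fix x y
  have "(norm (c *\<^sub>R T x - c *\<^sub>R T y))\<^sup>2 = c * (c * (norm (T x - T y))\<^sup>2)"
    by (simp flip: scaleR_diff_right add: power_mult_distrib power2_eq_square)
  also have "\<dots> \<le> c * (1 * (norm (T x - T y))\<^sup>2)"
    using c by (intro mult_left_mono mult_right_mono) auto
  also have "\<dots> \<le> c * ((T x - T y) \<bullet> (x - y))"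
    using T c by (simp add: firmly_nonexpansive_def mult_left_mono)
  also have "\<dots> = (c *\<^sub>R T x - c *\<^sub>R T y) \<bullet> (x - y)"
    by (simp flip: scaleR_diff_right)
  finally show "(norm (c *\<^sub>R T x - c *\<^sub>R T y))\<^sup>2 \<le> (c *\<^sub>R T x - c *\<^sub>R T y) \<bullet> (x - y)" .
qed

lemma norm_scaleR_firmly_nonexpansive_le:
  assumes "firmly_nonexpansive T" "0 \<le> c"
  shows "norm (c *\<^sub>R T x - c *\<^sub>R T y) \<le> c * norm (x - y)"
  using firmly_nonexpansive_norm_le[OF assms(1), of x y] assms(2)
  by (simp flip: scaleR_diff_right add: mult_left_mono)

lemma rho_hat_scaleR_tendsto_0:
  assumes T: "firmly_nonexpansive T" and c: "\<And>i. 0 \<le> c i" "\<And>i. c i \<le> 1" "c \<longlonglongrightarrow> 1"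
  shows "(\<lambda>i. rho_hat (\<lambda>x. c i *\<^sub>R T x) T) \<longlonglongrightarrow> 0"
proof (rule rho_hat_tendsto_0)
  show "firmly_nonexpansive (\<lambda>x. c i *\<^sub>R T x)" for i
    using T c by (intro firmly_nonexpansive_scaleR)
  show "uniform_limit (cball 0 r) (\<lambda>i x. c i *\<^sub>R T x) T sequentially" for r
  proof -
    have "norm (T x) \<le> r + norm (T 0)" if "x \<in> cball 0 r" for x
      using firmly_nonexpansive_norm_le[OF T, of x 0] norm_triangle_ineq2[of "T x" "T 0"] that
      by simp
    then have "bounded (T ` cball 0 r)"
      unfolding bounded_iff by blast
    then have "uniform_limit (cball 0 r) (\<lambda>i x. c i *\<^sub>R T x) (\<lambda>x. 1 *\<^sub>R T x) sequentially"
      using c(3) by (intro bounded_bilinear.bounded_uniform_limit[OF bounded_bilinear_scaleR])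
        (auto simp: image_constant_conv uniform_limit_iff tendsto_iff)
    then show ?thesis by simp
  qed
qed (fact T)

section \<open>Maps whose iterates contract a ball\<close>

text \<open>All but finitely many iterates \<open>T ^^ k\<close> send the ball of radius \<open>n\<close> about the origin into one
  closed ball of radius \<open>1 / (n + 1)\<close>, whose centre \<open>p\<close> may depend on \<open>n\<close> and need not be a
  fixed point of \<open>T\<close>.\<close>

definition attracting :: "nat \<Rightarrow> ('a::real_normed_vector \<Rightarrow> 'a) \<Rightarrow> bool" where
  "attracting n T \<longleftrightarrow>
     (\<exists>p N. \<forall>k\<ge>N. \<forall>x\<in>cball 0 (real n). dist ((T ^^ k) x) p \<le> 1 / real (Suc n))"

lemma super_regular_if_attracting:
  fixes T :: "'a::{real_normed_vector,complete_space} \<Rightarrow> 'a"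
  assumes "\<And>n. attracting n T"
  shows "super_regular T"
proof -
  obtain p N where pN: "\<And>n k x. k \<ge> N n \<Longrightarrow> norm x \<le> real n \<Longrightarrow>
      dist ((T ^^ k) x) (p n) \<le> 1 / real (Suc n)"
    using assms unfolding attracting_def by (simp add: Ball_def) metis
  have ex_n: "\<exists>n. s \<le> real n \<and> 1 / real (Suc n) < e" if e: "e > 0" for s e :: real
  proof -
    obtain m where "s \<le> real m" using real_arch_simple by blast
    obtain m' where m': "inverse (real (Suc m')) < e" using reals_Archimedean[OF e] by blast
    have "1 / real (Suc (max m m')) \<le> 1 / real (Suc m')"
      by (intro divide_left_mono) auto
    with m' have "1 / real (Suc (max m m')) < e"
      by (simp add: inverse_eq_divide)
    moreover have "s \<le> real (max m m')" using \<open>s \<le> real m\<close> by simp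
    ultimately show ?thesis by blast
  qed
  have "Cauchy (\<lambda>k. (T ^^ k) 0)"
  proof (rule metric_CauchyI)
    fix e :: real assume "e > 0"
    then obtain n where n: "1 / real (Suc n) < e / 2"
      using ex_n[of "e/2" 0] by auto
    have "dist ((T ^^ j) 0) ((T ^^ k) 0) < e" if "j \<ge> N n" "k \<ge> N n" for j k
      using pN[OF that(1), of 0] pN[OF that(2), of 0] n
        dist_triangle2[of "(T ^^ j) 0" "(T ^^ k) 0" "p n"] by simp
    then show "\<exists>M. \<forall>j\<ge>M. \<forall>k\<ge>M. dist ((T ^^ j) 0) ((T ^^ k) 0) < e" by blast
  qed
  then obtain q where q: "(\<lambda>k. (T ^^ k) 0) \<longlonglongrightarrow> q"
    using Cauchy_convergent convergent_def by blast
  have pq: "dist q (p n) \<le> 1 / real (Suc n)" for n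
  proof (rule LIMSEQ_le_const2)
    show "(\<lambda>k. dist ((T ^^ k) 0) (p n)) \<longlonglongrightarrow> dist q (p n)"
      by (intro tendsto_intros q)
    show "\<exists>M. \<forall>k\<ge>M. dist ((T ^^ k) 0) (p n) \<le> 1 / real (Suc n)"
      using pN[of n _ 0] by auto
  qed
  have "uniform_limit (cball 0 s) (\<lambda>k. T ^^ k) (\<lambda>_. q) sequentially" for s
  proof (rule uniform_limitI)
    fix e :: real assume "e > 0"
    then obtain n where n: "s \<le> real n" "1 / real (Suc n) < e / 2"
      using ex_n[of "e/2" s] by auto
    have "dist ((T ^^ k) x) q < e" if "k \<ge> N n" "x \<in> cball 0 s" for k x
      using pN[OF that(1), of x] that(2) n pq[of n] dist_triangle2[of "(T ^^ k) x" q "p n"]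
      by simp
    then show "\<forall>\<^sub>F k in sequentially. \<forall>x\<in>cball 0 s. dist ((T ^^ k) x) q < e"
      unfolding eventually_sequentially by blast
  qed
  moreover have "q' = q"
    if "\<forall>s>0. uniform_limit (cball 0 s) (\<lambda>k. T ^^ k) (\<lambda>_. q') sequentially" for q'
  proof -
    have "uniform_limit (cball 0 1) (\<lambda>k. T ^^ k) (\<lambda>_. q') sequentially"
      using that by simp
    then have "(\<lambda>k. (T ^^ k) 0) \<longlonglongrightarrow> q'"
      by (rule tendsto_uniform_limitI) simp
    then show ?thesis using q LIMSEQ_unique by blast
  qed
  ultimately show ?thesis
    unfolding super_regular_def by blast
qed

text \<open>The ball of radius \<open>r\<close> about \<open>p\<close> is preserved because \<open>L * r + e \<le> r\<close>; unrolling the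
  recursive bound gives a geometric series with sum at most \<open>e / (1 - L)\<close>.\<close>

lemma iterates_near_fixed_point:
  fixes S :: "'a::real_normed_vector \<Rightarrow> 'a"
  assumes L: "0 \<le> L" "L < 1" and e: "0 \<le> e" "e \<le> (1 - L) * r"
    and step: "\<And>x. norm (x - p) \<le> r \<Longrightarrow> norm (S x - p) \<le> L * norm (x - p) + e"
    and x: "norm (x - p) \<le> r"
  shows "norm ((S ^^ k) x - p) \<le> r \<and> norm ((S ^^ k) x - p) \<le> L ^ k * r + e / (1 - L)"
proof (induction k)
  case 0
  then show ?case using x e L by (simp add: add_increasing2)
next
  case (Suc k)
  let ?u = "norm ((S ^^ k) x - p)"
  have s: "norm ((S ^^ Suc k) x - p) \<le> L * ?u + e"
    using step Suc.IH by simp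
  have "L * ?u \<le> L * r" "L * ?u \<le> L * (L ^ k * r + e / (1 - L))"
    using Suc.IH L by (auto intro: mult_left_mono)
  moreover have "L * r + e \<le> r"
    using e(2) by (simp add: algebra_simps)
  moreover have "L * (L ^ k * r + e / (1 - L)) + e = L ^ Suc k * r + e / (1 - L)"
    using L by (simp add: field_simps)
  ultimately show ?case using s by linarith
qed

lemma attracting_near_contraction:
  fixes C :: "'a::{real_inner,complete_space} \<Rightarrow> 'a"
  assumes C: "firmly_nonexpansive C" and L: "0 \<le> L" "L < 1"
    and lip: "\<And>x y. norm (C x - C y) \<le> L * norm (x - y)"
  obtains d where "d > 0"
    "\<And>S. firmly_nonexpansive S \<Longrightarrow> rho_hat C S < d \<Longrightarrow> attracting n S"
proof -
  have "\<exists>!x. C x = x"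
    using banach_fix_type[of L C] L lip by (auto simp: dist_norm)
  then obtain p where p: "C p = p" by blast
  \<comment> \<open>The ball of radius \<open>r\<close> about \<open>p\<close> contains the ball of radius \<open>n\<close> about \<open>0\<close>, and
    \<open>e / (1 - L)\<close> is half of the required final radius.\<close>
  define r where "r = real (Suc n) + norm p"
  define e where "e = (1 - L) * (1 / (2 * real (Suc n)))"
  have "0 < e" using L by (simp add: e_def)
  have "1 / (2 * real (Suc n)) \<le> 1" by simp
  also have "1 \<le> r" by (simp add: r_def)
  finally have er: "e \<le> (1 - L) * r"
    unfolding e_def using L by (intro mult_left_mono) auto
  have "0 < r" by (simp add: r_def add_pos_nonneg)
  have "(\<lambda>k. L ^ k * r) \<longlonglongrightarrow> 0 * r"
    using L by (intro tendsto_intros LIMSEQ_power_zero) auto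
  then have "\<forall>\<^sub>F k in sequentially. L ^ k * r < 1 / (2 * real (Suc n))"
    by (intro order_tendstoD(2)) auto
  then obtain N where N: "\<And>k. k \<ge> N \<Longrightarrow> L ^ k * r < 1 / (2 * real (Suc n))"
    unfolding eventually_sequentially by blast
  \<comment> \<open>The ball of radius \<open>r\<close> about \<open>p\<close> lies in the ball of radius \<open>r + norm p\<close> about \<open>0\<close>.\<close>
  obtain d where d: "d > 0"
    "\<And>(S :: 'a \<Rightarrow> 'a) T x. \<lbrakk>firmly_nonexpansive S; firmly_nonexpansive T;
      rho_hat S T < d; norm x \<le> r + norm p\<rbrakk> \<Longrightarrow> norm (S x - T x) < e"
    using norm_diff_less_if_rho_hat_small[OF \<open>0 < e\<close>] by metis
  show thesis
  proof (rule that[OF d(1)])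
    fix S :: "'a \<Rightarrow> 'a"
    assume S: "firmly_nonexpansive S" and close: "rho_hat C S < d"
    have step: "norm (S x - p) \<le> L * norm (x - p) + e" if "norm (x - p) \<le> r" for x
    proof -
      have "norm x \<le> r + norm p"
        using that norm_triangle_ineq2[of x p] by simp
      then have "norm (C x - S x) < e"
        using d(2) C S close by blast
      moreover have "norm (C x - p) \<le> L * norm (x - p)"
        using lip[of x p] p by simp
      moreover have "norm (S x - p) \<le> norm (C x - S x) + norm (C x - p)"
        using norm_triangle_ineq4[of "C x - p" "C x - S x"] by simp
      ultimately show ?thesis by linarith
    qed
    have "dist ((S ^^ k) x) p \<le> 1 / real (Suc n)"
      if "k \<ge> N" and x: "x \<in> cball 0 (real n)" for k x
    proof -
      have "norm (x - p) \<le> r"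
        using x norm_triangle_ineq4[of x p] by (simp add: r_def)
      then have "norm ((S ^^ k) x - p) \<le> L ^ k * r + e / (1 - L)"
        using iterates_near_fixed_point[OF L less_imp_le[OF \<open>0 < e\<close>] er step] by blast
      also have "\<dots> \<le> 1 / (2 * real (Suc n)) + 1 / (2 * real (Suc n))"
        using N[OF that(1)] L by (intro add_mono) (auto simp: e_def)
      also have "\<dots> = 1 / real (Suc n)"
        by (simp add: field_simps)
      finally show ?thesis by (simp add: dist_norm)
    qed
    then show "attracting n S"
      unfolding attracting_def by blast
  qed
qed

section \<open>Residuality\<close>

theorem theorem2p15:
  shows "residual_in
           (Metric_space.mtopology
              (firmly_nonexpansive_maps :: ('a::{real_inner,complete_space} \<Rightarrow> 'a) set) rho_hat)
           {T \<in> firmly_nonexpansive_maps. super_regular T}"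
proof -
  interpret Metric_space "firmly_nonexpansive_maps :: ('a \<Rightarrow> 'a) set" rho_hat
    by (rule Metric_space_rho_hat)
  let ?J = "firmly_nonexpansive_maps :: ('a \<Rightarrow> 'a) set"
  define G where "G = (\<lambda>n. mtopology interior_of {T \<in> ?J. attracting n T})"
  have "mtopology closure_of (G n) = ?J" for n
  proof -
    have "\<exists>S \<in> G n. S \<in> mball T r" if T: "T \<in> ?J" and "r > 0" for T r
    proof -
      have fT: "firmly_nonexpansive T" using T by (simp add: firmly_nonexpansive_maps_def)
      define c :: "nat \<Rightarrow> real" where "c = (\<lambda>i. 1 - 1 / real (Suc i))"
      have c: "0 \<le> c i" "c i < 1" for i by (auto simp: c_def)
      have "c \<longlonglongrightarrow> 1 - 0"
        unfolding c_def using LIMSEQ_inverse_real_of_nat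
        by (intro tendsto_intros) (simp add: inverse_eq_divide)
      then have "(\<lambda>i. rho_hat (\<lambda>x. c i *\<^sub>R T x) T) \<longlonglongrightarrow> 0"
        using fT c by (intro rho_hat_scaleR_tendsto_0) (auto intro: less_imp_le)
      then have "\<forall>\<^sub>F i in sequentially. rho_hat (\<lambda>x. c i *\<^sub>R T x) T < r"
        using \<open>r > 0\<close> by (rule order_tendstoD(2))
      then obtain i where i: "rho_hat (\<lambda>x. c i *\<^sub>R T x) T < r"
        using eventually_happens by fastforce
      define C where "C = (\<lambda>x. c i *\<^sub>R T x)"
      have C: "firmly_nonexpansive C"
        unfolding C_def using fT c less_imp_le by (intro firmly_nonexpansive_scaleR) auto
      then have CJ: "C \<in> ?J" by (simp add: firmly_nonexpansive_maps_def)
      have "norm (C x - C y) \<le> c i * norm (x - y)" for x y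
        unfolding C_def using fT c by (intro norm_scaleR_firmly_nonexpansive_le)
      then obtain d where d: "d > 0"
        "\<And>S. firmly_nonexpansive S \<Longrightarrow> rho_hat C S < d \<Longrightarrow> attracting n S"
        using attracting_near_contraction[OF C c] by blast
      have "mball C d \<subseteq> {T \<in> ?J. attracting n T}"
      proof
        fix S assume "S \<in> mball C d"
        then have "S \<in> ?J" "rho_hat C S < d" by simp_all
        then show "S \<in> {T \<in> ?J. attracting n T}"
          using d(2) by (simp add: firmly_nonexpansive_maps_def)
      qed
      then have "mball C d \<subseteq> G n"
        unfolding G_def by (intro interior_of_maximal) auto
      then have "C \<in> G n"
        using d(1) CJ by auto
      moreover have "C \<in> mball T r"
        using i T CJ by (simp add: C_def commute)
      ultimately show ?thesis by blast
    qed
    then show ?thesis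
      by (auto simp: metric_closure_of)
  qed
  moreover have "openin mtopology (G n)" for n
    by (simp add: G_def)
  moreover have "(\<Inter>n. G n) \<subseteq> {T \<in> ?J. super_regular T}"
  proof
    fix T assume "T \<in> (\<Inter>n. G n)"
    then have "T \<in> ?J \<and> attracting n T" for n
      using interior_of_subset[of mtopology "{T \<in> ?J. attracting n T}"] by (auto simp: G_def)
    then show "T \<in> {T \<in> ?J. super_regular T}"
      by (auto intro: super_regular_if_attracting)
  qed
  ultimately show ?thesis
    unfolding residual_in_def by (auto intro!: exI[of _ G])
qed

end
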